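(* Let $\varphi\in\mathcal{L}$. Then $\varphi$ is satisfiable relative to the class $\mathbf{QMDM}$ of quasi-multi-decision models if and only if it is satisfiable relative to the class of finite quasi-multi-decision models.
   Context: Let $\mathit{Atm}_0$ be a countable (finite or infinite) set of atomic propositions and $\mathit{Val}$ a finite set of output values; decision atoms $\mathsf{t}(x)$ for $x\in\mathit{Val}$, $\mathit{Dec}=\{\mathsf{t}(x):x\in\mathit{Val}\}$, $\mathit{Atm}=\mathit{Atm}_0\cup\mathit{Dec}$. Language $\mathcal{L}$: $\varphi ::= p \mid \mathsf{t}(x)\mid \neg\varphi\mid \varphi\wedge\varphi\mid \Box_{\mathtt{I}}\varphi\mid \Box_{\mathtt{F}}\varphi$ ($p\in\mathit{Atm}_0$, $x\in\mathit{Val}$). A quasi-multi-decision model (quasi-MDM) is a tuple $M=(W,\sim_{\Box_{\mathtt{I}}},\sim_{\Box_{\mathtt{F}}},V)$ with $W$ a set, $\sim_{\Box_{\mathtt{I}}},\sim_{\Box_{\mathtt{F}}}$ equivalence relations on $W$, $V:W\to2^{\mathit{Atm}}$, writing $V_Y(w)=V(w)\cap Y$, such that for all $w,v\in W$, $x,y\in\mathit{Val}$: (C1) $\sim_{\Box_{\mathtt{I}}}\circ\sim_{\Box_{\mathtt{F}}}=\sim_{\Box_{\mathtt{F}}}\circ\sim_{\Box_{\mathtt{I}}}$; (C3) if $w\sim_{\Box_{\mathtt{F}}}v$ then $V_{\mathit{Atm}_0}(w)=V_{\mathit{Atm}_0}(v)$; (C4) if $\mathsf{t}(x)\in V(w)$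 and $x\neq y$ then $\mathsf{t}(y)\notin V(w)$; (C5) some $\mathsf{t}(x)\in V(w)$. It is finite if $W$ is finite. Truth: atoms $q\in\mathit{Atm}$ true at $w$ iff $q\in V(w)$; Boolean connectives as usual; $\Box_{\mathtt{I}}\varphi$ (resp. $\Box_{\mathtt{F}}\varphi$) true at $w$ iff $\varphi$ true at all $\sim_{\Box_{\mathtt{I}}}$- (resp. $\sim_{\Box_{\mathtt{F}}}$-) related worlds. *)

theory Defs
  imports "HOL-Library.Countable_Set"
begin

(* The atomic propositions and the output values are carrier sets Atm0 :: 'p set and Val :: 'v set
   (either may be empty); the constructors keep decision atoms apart from Atm0. *)

datatype ('p, 'v) atom = Prop 'p | Dec 'v

definition Atm :: "'p set \<Rightarrow> 'v set \<Rightarrow> ('p, 'v) atom set" where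
  "Atm Atm0 Val = Prop ` Atm0 \<union> Dec ` Val"

datatype ('p, 'v) fm =
    Atom "('p, 'v) atom"
  | Neg "('p, 'v) fm"
  | Conj "('p, 'v) fm" "('p, 'v) fm"
  | BoxI "('p, 'v) fm"
  | BoxF "('p, 'v) fm"

inductive_set lang :: "'p set \<Rightarrow> 'v set \<Rightarrow> ('p, 'v) fm set"
  for Atm0 :: "'p set" and Val :: "'v set" where
  lang_Prop: "p \<in> Atm0 \<Longrightarrow> Atom (Prop p) \<in> lang Atm0 Val"
| lang_Dec: "x \<in> Val \<Longrightarrow> Atom (Dec x) \<in> lang Atm0 Val"
| lang_Neg: "\<phi> \<in> lang Atm0 Val \<Longrightarrow> Neg \<phi> \<in> lang Atm0 Val"
| lang_Conj: "\<phi> \<in> lang Atm0 Val \<Longrightarrow> \<psi> \<in> lang Atm0 Val \<Longrightarrow> Conj \<phi> \<psi> \<in> lang Atm0 Val"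
| lang_BoxI: "\<phi> \<in> lang Atm0 Val \<Longrightarrow> BoxI \<phi> \<in> lang Atm0 Val"
| lang_BoxF: "\<phi> \<in> lang Atm0 Val \<Longrightarrow> BoxF \<phi> \<in> lang Atm0 Val"

record ('w, 'p, 'v) model =
  worlds :: "'w set"
  relI :: "'w rel"
  relF :: "'w rel"
  val :: "'w \<Rightarrow> ('p, 'v) atom set"

primrec holds :: "('w, 'p, 'v) model \<Rightarrow> 'w \<Rightarrow> ('p, 'v) fm \<Rightarrow> bool" where
  "holds M w (Atom q) \<longleftrightarrow> q \<in> val M w"
| "holds M w (Neg \<phi>) \<longleftrightarrow> \<not> holds M w \<phi>"
| "holds M w (Conj \<phi> \<psi>) \<longleftrightarrow> holds M w \<phi> \<and> holds M w \<psi>"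
| "holds M w (BoxI \<phi>) \<longleftrightarrow> (\<forall>v. (w, v) \<in> relI M \<longrightarrow> holds M v \<phi>)"
| "holds M w (BoxF \<phi>) \<longleftrightarrow> (\<forall>v. (w, v) \<in> relF M \<longrightarrow> holds M v \<phi>)"

(* val M is constrained on worlds M only; its values elsewhere play no role. *)

definition QMDM :: "'p set \<Rightarrow> 'v set \<Rightarrow> ('w, 'p, 'v) model set" where
  "QMDM Atm0 Val = {M.
     equiv (worlds M) (relI M) \<and>
     equiv (worlds M) (relF M) \<and>
     (\<forall>w\<in>worlds M. val M w \<subseteq> Atm Atm0 Val) \<and>
     relI M O relF M = relF M O relI M \<and>
     (\<forall>w\<in>worlds M. \<forall>v\<in>worlds M. (w, v) \<in> relF M \<longrightarrow>
        val M w \<inter> Prop ` Atm0 = val M v \<inter> Prop ` Atm0) \<and>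
     (\<forall>w\<in>worlds M. \<forall>x\<in>Val. \<forall>y\<in>Val. Dec x \<in> val M w \<and> x \<noteq> y \<longrightarrow> Dec y \<notin> val M w) \<and>
     (\<forall>w\<in>worlds M. \<exists>x\<in>Val. Dec x \<in> val M w)}"

definition finite_QMDM :: "'p set \<Rightarrow> 'v set \<Rightarrow> ('w, 'p, 'v) model set" where
  "finite_QMDM Atm0 Val = {M \<in> QMDM Atm0 Val. finite (worlds M)}"

(* A class of models lives over one type 'w of possible worlds; a statement with 'w free holds for
   every such type, hence for models over arbitrary sets. *)

definition satisfiable :: "('w, 'p, 'v) model set \<Rightarrow> ('p, 'v) fm \<Rightarrow> bool" where
  "satisfiable C \<phi> \<longleftrightarrow> (\<exists>M\<in>C. \<exists>w\<in>worlds M. holds M w \<phi>)"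

end

theory Submission
  imports Defs
begin

text \<open>
  Restrict a model to the worlds generated by a point \<open>w\<^sub>0\<close>. There the two relations commute and their
  composition is universal, so every \<open>\<sim>\<^sub>I\<close>-class meets every \<open>\<sim>\<^sub>F\<close>-class. Identify worlds that agree
  on their type (the set of true formulas from a finite set \<open>\<Gamma>\<close>), on the set of types occurring in
  their \<open>\<sim>\<^sub>I\<close>-class and on the set of types occurring in their \<open>\<sim>\<^sub>F\<close>-class, and relate two worlds when
  their classes realise the same types. Because any two classes meet, the composition of the new
  relations is again universal, in either order, which gives (C1). The quotient is realised on a set
  of representatives, so that the type of worlds does not change.
\<close>

primrec subfms :: "('p, 'v) fm \<Rightarrow> ('p, 'v) fm set" where
  "subfms (Atom q) = {Atom q}"
| "subfms (Neg \<phi>) = insert (Neg \<phi>) (subfms \<phi>)"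
| "subfms (Conj \<phi> \<psi>) = insert (Conj \<phi> \<psi>) (subfms \<phi> \<union> subfms \<psi>)"
| "subfms (BoxI \<phi>) = insert (BoxI \<phi>) (subfms \<phi>)"
| "subfms (BoxF \<phi>) = insert (BoxF \<phi>) (subfms \<phi>)"

lemma self_in_subfms: "\<phi> \<in> subfms \<phi>"
  by (cases \<phi>) auto

lemma finite_subfms: "finite (subfms \<phi>)"
  by (induction \<phi>) auto

definition type_of :: "('p, 'v) fm set \<Rightarrow> ('w, 'p, 'v) model \<Rightarrow> 'w \<Rightarrow> ('p, 'v) fm set" where
  "type_of \<Gamma> M w = {\<psi> \<in> \<Gamma>. holds M w \<psi>}"

text \<open>The relation is a parameter, separate from \<open>M\<close>, so that the lemmas on class
  types serve \<open>relI M\<close> and \<open>relF M\<close> alike.\<close>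

definition class_types ::
    "('p, 'v) fm set \<Rightarrow> ('w, 'p, 'v) model \<Rightarrow> 'w rel \<Rightarrow> 'w \<Rightarrow> ('p, 'v) fm set set" where
  "class_types \<Gamma> M R w = type_of \<Gamma> M ` (R `` {w})"

definition profile :: "('p, 'v) fm set \<Rightarrow> ('w, 'p, 'v) model \<Rightarrow> 'w \<Rightarrow>
    ('p, 'v) fm set \<times> ('p, 'v) fm set set \<times> ('p, 'v) fm set set" where
  "profile \<Gamma> M w =
     (type_of \<Gamma> M w, class_types \<Gamma> M (relI M) w, class_types \<Gamma> M (relF M) w)"

text \<open>\<open>X\<close> is meant to be a set of representatives of the profiles. Valuations are
  cut down to \<Gamma> because worlds related by the new \<open>relF\<close> are only known to agree
  on (C3)-atoms that the types can see.\<close>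

definition filtration ::
    "('p, 'v) fm set \<Rightarrow> ('w, 'p, 'v) model \<Rightarrow> 'w set \<Rightarrow> ('w, 'p, 'v) model" where
  "filtration \<Gamma> M X =
     \<lparr>worlds = X,
      relI = {(u, v) \<in> X \<times> X. class_types \<Gamma> M (relI M) u = class_types \<Gamma> M (relI M) v},
      relF = {(u, v) \<in> X \<times> X. class_types \<Gamma> M (relF M) u = class_types \<Gamma> M (relF M) v},
      val = (\<lambda>w. {q \<in> val M w. Atom q \<in> \<Gamma>})\<rparr>"

lemma filtration_simps [simp]:
  "worlds (filtration \<Gamma> M X) = X"
  "(u, v) \<in> relI (filtration \<Gamma> M X) \<longleftrightarrow> u \<in> X \<and> v \<in> X \<and>
     class_types \<Gamma> M (relI M) u = class_types \<Gamma> M (relI M) v"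
  "(u, v) \<in> relF (filtration \<Gamma> M X) \<longleftrightarrow> u \<in> X \<and> v \<in> X \<and>
     class_types \<Gamma> M (relF M) u = class_types \<Gamma> M (relF M) v"
  "val (filtration \<Gamma> M X) w = {q \<in> val M w. Atom q \<in> \<Gamma>}"
  by (simp_all add: filtration_def)

lemma type_of_eq_iff:
  "type_of \<Gamma> M u = type_of \<Gamma> M v \<longleftrightarrow> (\<forall>\<psi>\<in>\<Gamma>. holds M u \<psi> = holds M v \<psi>)"
  by (auto simp: type_of_def)

lemma class_types_eq:
  assumes "equiv W R" "(u, v) \<in> R"
  shows "class_types \<Gamma> M R u = class_types \<Gamma> M R v"
  using equiv_class_eq[OF assms] by (simp add: class_types_def)

text \<open>By reflexivity the type of \<open>v\<close> occurs in its own class, hence also in the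
  class of \<open>u\<close>. This turns a link of the filtration into a genuine
  \<open>R\<close>-link, up to the type of the target.\<close>

lemma class_types_eqD:
  assumes "equiv W R" "v \<in> W" "class_types \<Gamma> M R u = class_types \<Gamma> M R v"
  obtains v' where "(u, v') \<in> R" "type_of \<Gamma> M v' = type_of \<Gamma> M v"
proof -
  have "v \<in> R `` {v}" using assms(1,2) by (rule equiv_class_self)
  then have "type_of \<Gamma> M v \<in> class_types \<Gamma> M R v"
    unfolding class_types_def by (rule imageI)
  then have "type_of \<Gamma> M v \<in> class_types \<Gamma> M R u"
    by (simp only: assms(3))
  then obtain v' where "v' \<in> R `` {u}" "type_of \<Gamma> M v = type_of \<Gamma> M v'"
    unfolding class_types_def by (rule imageE)
  then show thesis using that[of v'] by simp
qed

lemma finite_profile_image: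
  assumes "finite \<Gamma>"
  shows "finite (profile \<Gamma> M ` U)"
proof (rule finite_subset)
  show "profile \<Gamma> M ` U \<subseteq> Pow \<Gamma> \<times> Pow (Pow \<Gamma>) \<times> Pow (Pow \<Gamma>)"
    by (auto simp: profile_def class_types_def type_of_def)
qed (use assms in simp)

text \<open>\<open>X\<close> need not be closed under the relations: by \<open>rep\<close>, every
  successor of a world of \<open>X\<close> has a twin in \<open>X\<close> with the same profile. In
  the box cases twins carry truth from the filtration to \<open>M\<close>, and
  \<open>class_types_eqD\<close> carries it back.\<close>

lemma holds_filtration:
  assumes eqI: "equiv (worlds M) (relI M)" and eqF: "equiv (worlds M) (relF M)"
    and X: "X \<subseteq> worlds M"
    and rep: "\<And>w v. w \<in> X \<Longrightarrow> (w, v) \<in> relI M \<or> (w, v) \<in> relF M \<Longrightarrow>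
                \<exists>v'\<in>X. profile \<Gamma> M v' = profile \<Gamma> M v"
    and "subfms \<psi> \<subseteq> \<Gamma>" and "w \<in> X"
  shows "holds (filtration \<Gamma> M X) w \<psi> \<longleftrightarrow> holds M w \<psi>"
  using assms(5,6)
proof (induction \<psi> arbitrary: w)
  case (BoxI \<psi>)
  have \<psi>: "\<psi> \<in> \<Gamma>" using BoxI.prems self_in_subfms by auto
  have IH: "holds (filtration \<Gamma> M X) v \<psi> \<longleftrightarrow> holds M v \<psi>" if "v \<in> X" for v
    using BoxI that by simp
  show ?case
  proof
    assume L: "holds (filtration \<Gamma> M X) w (BoxI \<psi>)"
    have "holds M v \<psi>" if wv: "(w, v) \<in> relI M" for v
    proof -
      obtain v' where v': "v' \<in> X" "profile \<Gamma> M v' = profile \<Gamma> M v"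
        using rep BoxI.prems wv by blast
      \<comment> \<open>The class types of \<open>w\<close> are those of its successor
        \<open>v\<close>, and the twin \<open>v'\<close> shares them through its profile.\<close>
      then have "(w, v') \<in> relI (filtration \<Gamma> M X)"
        using BoxI.prems class_types_eq[OF eqI wv, of \<Gamma> M] by (simp add: profile_def)
      then have "holds M v' \<psi>" using L IH[OF v'(1)] by (simp del: filtration_simps)
      then show ?thesis using v' \<psi> by (simp add: profile_def type_of_eq_iff)
    qed
    then show "holds M w (BoxI \<psi>)" by simp
  next
    assume R: "holds M w (BoxI \<psi>)"
    have "holds M v \<psi>"
      if v: "v \<in> X" "class_types \<Gamma> M (relI M) w = class_types \<Gamma> M (relI M) v" for v
    proof -
      have "v \<in> worlds M" using X v(1) by blast
      then obtain v' where "(w, v') \<in> relI M" "type_of \<Gamma> M v' = type_of \<Gamma> M v"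
        using class_types_eqD[OF eqI _ v(2)] by metis
      then show ?thesis using R \<psi> unfolding type_of_eq_iff holds.simps by blast
    qed
    then show "holds (filtration \<Gamma> M X) w (BoxI \<psi>)" using IH by simp
  qed
next
  case (BoxF \<psi>)
  have \<psi>: "\<psi> \<in> \<Gamma>" using BoxF.prems self_in_subfms by auto
  have IH: "holds (filtration \<Gamma> M X) v \<psi> \<longleftrightarrow> holds M v \<psi>" if "v \<in> X" for v
    using BoxF that by simp
  show ?case
  proof
    assume L: "holds (filtration \<Gamma> M X) w (BoxF \<psi>)"
    have "holds M v \<psi>" if wv: "(w, v) \<in> relF M" for v
    proof -
      obtain v' where v': "v' \<in> X" "profile \<Gamma> M v' = profile \<Gamma> M v"
        using rep BoxF.prems wv by blast
      then have "(w, v') \<in> relF (filtration \<Gamma> M X)"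
        using BoxF.prems class_types_eq[OF eqF wv, of \<Gamma> M] by (simp add: profile_def)
      then have "holds M v' \<psi>" using L IH[OF v'(1)] by (simp del: filtration_simps)
      then show ?thesis using v' \<psi> by (simp add: profile_def type_of_eq_iff)
    qed
    then show "holds M w (BoxF \<psi>)" by simp
  next
    assume R: "holds M w (BoxF \<psi>)"
    have "holds M v \<psi>"
      if v: "v \<in> X" "class_types \<Gamma> M (relF M) w = class_types \<Gamma> M (relF M) v" for v
    proof -
      have "v \<in> worlds M" using X v(1) by blast
      then obtain v' where "(w, v') \<in> relF M" "type_of \<Gamma> M v' = type_of \<Gamma> M v"
        using class_types_eqD[OF eqF _ v(2)] by metis
      then show ?thesis using R \<psi> unfolding type_of_eq_iff holds.simps by blast
    qed
    then show "holds (filtration \<Gamma> M X) w (BoxF \<psi>)" using IH by simp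
  qed
qed auto

text \<open>\<open>meet\<close> makes the composition of the new relations universal on
  \<open>X\<close>, which yields (C1); \<open>dec\<close> keeps every decision atom in the
  valuation, which yields (C5).\<close>

lemma filtration_QMDM:
  assumes M: "M \<in> QMDM Atm0 Val" and X: "X \<subseteq> worlds M"
    and dec: "\<And>x. x \<in> Val \<Longrightarrow> Atom (Dec x) \<in> \<Gamma>"
    and meet: "\<And>u v. u \<in> X \<Longrightarrow> v \<in> X \<Longrightarrow>
      \<exists>z\<in>X. class_types \<Gamma> M (relI M) z = class_types \<Gamma> M (relI M) u \<and>
            class_types \<Gamma> M (relF M) z = class_types \<Gamma> M (relF M) v"
  shows "filtration \<Gamma> M X \<in> QMDM Atm0 Val"
proof -
  let ?N = "filtration \<Gamma> M X"
  have eqF: "equiv (worlds M) (relF M)"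
    and atm: "\<forall>w\<in>worlds M. val M w \<subseteq> Atm Atm0 Val"
    and C3: "\<forall>w\<in>worlds M. \<forall>v\<in>worlds M. (w, v) \<in> relF M \<longrightarrow>
               val M w \<inter> Prop ` Atm0 = val M v \<inter> Prop ` Atm0"
    and C4: "\<forall>w\<in>worlds M. \<forall>x\<in>Val. \<forall>y\<in>Val.
               Dec x \<in> val M w \<and> x \<noteq> y \<longrightarrow> Dec y \<notin> val M w"
    and C5: "\<forall>w\<in>worlds M. \<exists>x\<in>Val. Dec x \<in> val M w"
    using M unfolding QMDM_def mem_Collect_eq by - (elim conjE, assumption)+
  show ?thesis
    unfolding QMDM_def mem_Collect_eq filtration_simps(1)
  proof (intro conjI ballI impI)
    show "equiv X (relI ?N)" "equiv X (relF ?N)"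
      by (auto simp: equiv_def refl_on_def sym_def trans_def)
  next
    have "relI ?N O relF ?N = X \<times> X"
    proof (intro equalityI subrelI)
      fix u v assume "(u, v) \<in> X \<times> X"
      then obtain z where "(u, z) \<in> relI ?N" "(z, v) \<in> relF ?N" using meet[of u v] by auto
      then show "(u, v) \<in> relI ?N O relF ?N" by (rule relcompI)
    qed auto
    moreover have "relF ?N O relI ?N = X \<times> X"
    proof (intro equalityI subrelI)
      fix u v assume "(u, v) \<in> X \<times> X"
      \<comment> \<open>With the arguments swapped, \<open>z\<close> takes its \<open>relI\<close>
        class types from \<open>v\<close> and its \<open>relF\<close> class types from
        \<open>u\<close>.\<close>
      then obtain z where "(u, z) \<in> relF ?N" "(z, v) \<in> relI ?N" using meet[of v u] by auto
      then show "(u, v) \<in> relF ?N O relI ?N" by (rule relcompI)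
    qed auto
    ultimately show "relI ?N O relF ?N = relF ?N O relI ?N" by simp
  next
    fix w v assume "w \<in> X" "v \<in> X" and wv: "(w, v) \<in> relF ?N"
    then have W: "w \<in> worlds M" "v \<in> worlds M" using X by blast+
    have "class_types \<Gamma> M (relF M) w = class_types \<Gamma> M (relF M) v" using wv by simp
    from class_types_eqD[OF eqF W(2) this]
    obtain v' where v': "(w, v') \<in> relF M" "type_of \<Gamma> M v' = type_of \<Gamma> M v" .
    have "v' \<in> worlds M" using v'(1) equiv_class_eq_iff[OF eqF] by blast
    then have "val M w \<inter> Prop ` Atm0 = val M v' \<inter> Prop ` Atm0"
      using C3 W(1) v'(1) by blast
    moreover have "holds M v' (Atom q) = holds M v (Atom q)" if "Atom q \<in> \<Gamma>" for q
      using v'(2) that unfolding type_of_eq_iff by blast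
    \<comment> \<open>The world \<open>v'\<close> may lie outside \<open>X\<close>, but
      \<open>val ?N\<close> is given by the same formula there.\<close>
    then have "val ?N v' = val ?N v" by auto
    ultimately show "val ?N w \<inter> Prop ` Atm0 = val ?N v \<inter> Prop ` Atm0"
      unfolding filtration_simps(4) by blast
  next
    fix w assume "w \<in> X"
    then have W: "w \<in> worlds M" using X by blast
    have sub: "val ?N w \<subseteq> val M w" by auto
    show "val ?N w \<subseteq> Atm Atm0 Val" using atm W sub by blast
    obtain x where "x \<in> Val" "Dec x \<in> val M w" using C5 W by blast
    then show "\<exists>x\<in>Val. Dec x \<in> val ?N w" using dec by (intro bexI[of _ x]) simp_all
    show "Dec y \<notin> val ?N w"
      if "x \<in> Val" "y \<in> Val" "Dec x \<in> val ?N w \<and> x \<noteq> y" for x y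
      using C4 W sub that by blast
  qed
qed

lemma finite_representatives:
  assumes "finite (f ` U)"
  obtains X where "X \<subseteq> U" "finite X" "\<And>u. u \<in> U \<Longrightarrow> \<exists>v\<in>X. f v = f u"
proof -
  obtain X where "X \<subseteq> U" "finite X" "f ` U = f ` X"
    using finite_subset_image[OF assms order_refl] by metis
  then show thesis using that by (metis imageE imageI)
qed

lemma QMDM_finite_model:
  fixes M :: "('w, 'p, 'v) model"
  assumes M: "M \<in> QMDM Atm0 Val" and "finite Val"
    and w0: "w0 \<in> worlds M" and sat: "holds M w0 \<phi>"
  shows "satisfiable (finite_QMDM Atm0 Val :: ('w, 'p, 'v) model set) \<phi>"
proof -
  let ?I = "relI M" and ?F = "relF M"
  have eqI: "equiv (worlds M) ?I" and eqF: "equiv (worlds M) ?F" and C1: "?I O ?F = ?F O ?I"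
    using M by (auto simp: QMDM_def)
  have II: "?I O ?I = ?I" and FF: "?F O ?F = ?F" and cI: "?I\<inverse> = ?I" and cF: "?F\<inverse> = ?F"
  proof -
    show cI: "?I\<inverse> = ?I" and cF: "?F\<inverse> = ?F"
      using eqI eqF by (simp_all add: equiv_def sym_conv_converse_eq)
    show "?I O ?I = ?I" "?F O ?F = ?F"
      using equiv_comp_eq[OF eqI] equiv_comp_eq[OF eqF] by (simp_all only: cI cF)
  qed
  \<comment> \<open>All decision atoms are added, even those not occurring in \<phi>, so that (C5)
    survives; finiteness of \<open>Val\<close> keeps \<Gamma> finite.\<close>
  define \<Gamma> where "\<Gamma> = subfms \<phi> \<union> (\<lambda>x. Atom (Dec x)) ` Val"
  \<comment> \<open>Since the relations commute, one \<open>?I\<close>-step followed by one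
    \<open>?F\<close>-step already reaches everything generated by \<open>w0\<close>.\<close>
  define U where "U = (?I O ?F) `` {w0}"
  have UW: "U \<subseteq> worlds M"
    using eqF unfolding U_def equiv_def by auto
  have w0U: "w0 \<in> U"
    using w0 eqI eqF unfolding U_def equiv_def refl_on_def by auto
  have "(?I O ?F) O ?F = ?I O ?F" "(?I O ?F) O ?I = ?I O ?F"
    by (metis O_assoc FF) (metis O_assoc C1 II)
  then have UI: "v \<in> U" if "u \<in> U" "(u, v) \<in> ?I \<or> (u, v) \<in> ?F" for u v
    using that unfolding U_def by blast
  \<comment> \<open>The converse of \<open>?I O ?F\<close> is \<open>?F O ?I\<close>, which equals
    \<open>?I O ?F\<close> by (C1); the four factors then collapse to two.\<close>
  have idem: "(?I O ?F)\<inverse> O (?I O ?F) = ?I O ?F"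
    by (metis converse_relcomp cI cF O_assoc C1 II FF)
  have meetU: "\<exists>z\<in>U. (u, z) \<in> ?I \<and> (z, v) \<in> ?F" if "u \<in> U" "v \<in> U" for u v
  proof -
    \<comment> \<open>The path leads from \<open>u\<close> back to \<open>w0\<close> and on to
      \<open>v\<close>.\<close>
    have "(u, v) \<in> (?I O ?F)\<inverse> O (?I O ?F)" using that unfolding U_def by blast
    then show ?thesis using idem UI that by blast
  qed
  have "finite \<Gamma>" using assms(2) finite_subfms by (simp add: \<Gamma>_def)
  then obtain X where X: "X \<subseteq> U" "finite X"
    and rep: "\<And>u. u \<in> U \<Longrightarrow> \<exists>v\<in>X. profile \<Gamma> M v = profile \<Gamma> M u"
    using finite_representatives[OF finite_profile_image] by metis
  have "filtration \<Gamma> M X \<in> QMDM Atm0 Val"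
  proof (rule filtration_QMDM[OF M])
    fix u v assume "u \<in> X" "v \<in> X"
    then obtain z where z: "z \<in> U" "(u, z) \<in> ?I" "(z, v) \<in> ?F" using meetU X by blast
    \<comment> \<open>The meeting world \<open>z\<close> may be missing from \<open>X\<close>; its
      representative need not be related to \<open>u\<close> or \<open>v\<close> in
      \<open>M\<close>, but it has the same class types as \<open>z\<close>, which is all that is
      required.\<close>
    then obtain z' where "z' \<in> X" "profile \<Gamma> M z' = profile \<Gamma> M z" using rep by blast
    then show "\<exists>z\<in>X. class_types \<Gamma> M ?I z = class_types \<Gamma> M ?I u \<and>
                     class_types \<Gamma> M ?F z = class_types \<Gamma> M ?F v"
      using class_types_eq[OF eqI z(2), of \<Gamma> M] class_types_eq[OF eqF z(3), of \<Gamma> M]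
      by (intro bexI[of _ z']) (simp_all add: profile_def)
  qed (use X UW in \<open>auto simp: \<Gamma>_def\<close>)
  then have fin: "filtration \<Gamma> M X \<in> finite_QMDM Atm0 Val"
    using X by (simp add: finite_QMDM_def)
  obtain v where v: "v \<in> X" "profile \<Gamma> M v = profile \<Gamma> M w0" using rep w0U by blast
  have "\<phi> \<in> \<Gamma>" using self_in_subfms by (auto simp: \<Gamma>_def)
  then have "holds M v \<phi>" using v sat by (auto simp: profile_def type_of_eq_iff)
  moreover have "holds (filtration \<Gamma> M X) v \<phi> \<longleftrightarrow> holds M v \<phi>"
  proof (rule holds_filtration[OF eqI eqF])
    show "X \<subseteq> worlds M" using X UW by blast
    show "\<exists>v'\<in>X. profile \<Gamma> M v' = profile \<Gamma> M v"
      if "w \<in> X" "(w, v) \<in> ?I \<or> (w, v) \<in> ?F" for w v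
      using that rep UI X by blast
  qed (use v in \<open>auto simp: \<Gamma>_def\<close>)
  ultimately show ?thesis
    unfolding satisfiable_def using fin v(1) by (intro bexI[of _ "filtration \<Gamma> M X"] bexI[of _ v]) simp_all
qed

theorem theorem4:
  fixes Atm0 :: "'p set" and Val :: "'v set" and \<phi> :: "('p, 'v) fm"
  assumes "countable Atm0" and "finite Val"
    and "\<phi> \<in> lang Atm0 Val"
  shows "satisfiable (QMDM Atm0 Val :: ('w, 'p, 'v) model set) \<phi> \<longleftrightarrow>
         satisfiable (finite_QMDM Atm0 Val :: ('w, 'p, 'v) model set) \<phi>"
proof
  assume "satisfiable (QMDM Atm0 Val :: ('w, 'p, 'v) model set) \<phi>"
  then obtain M :: "('w, 'p, 'v) model" and w
    where "M \<in> QMDM Atm0 Val" "w \<in> worlds M" "holds M w \<phi>"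
    unfolding satisfiable_def by blast
  then show "satisfiable (finite_QMDM Atm0 Val :: ('w, 'p, 'v) model set) \<phi>"
    by (rule QMDM_finite_model[OF _ assms(2)])
next
  assume "satisfiable (finite_QMDM Atm0 Val :: ('w, 'p, 'v) model set) \<phi>"
  then show "satisfiable (QMDM Atm0 Val :: ('w, 'p, 'v) model set) \<phi>"
    by (auto simp: satisfiable_def finite_QMDM_def)
qed

end
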